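(* Let $R=\{(0,0),(0,1),(0,2),(3,0),(1,1),(2,1),(2,2),(2,3),(3,1)\}$ and $R'=\{(0,0),(1,0),(2,0),(0,3),(1,1),(1,2),(1,3),(2,2),(3,2)\}$. Then $(123,R)\sim_{jd}(132,R)$ and $(123,R')\sim_{jd}(132,R')$.
   Context: $S_n$ is the set of permutations $\pi=\pi_1\cdots\pi_n$ of $\{1,\dots,n\}$. A mesh pattern of length $k$ is a pair $(\tau,R)$ with $\tau\in S_k$ and $R\subseteq\{0,\dots,k\}\times\{0,\dots,k\}$ (the set of shaded boxes; box $(a,b)$ is the unit square with lower-left corner $(a,b)$). An occurrence of $(\tau,R)$ in $\pi\in S_n$ is a subsequence $\pi_{i_1}\cdots\pi_{i_k}$, $i_1<\dots<i_k$, order-isomorphic to $\tau$, such that, with $i_0=0$, $i_{k+1}=n+1$, with $v_1<\dots<v_k$ the values $\pi_{i_1},\dots,\pi_{i_k}$ in increasing order, and $v_0=0$, $v_{k+1}=n+1$, for each $(a,b)\in R$ there is no index $m$ with $i_a<m<i_{a+1}$ and $v_b<\pi_m<v_{b+1}$. Two mesh patterns $q_1,q_2$ are jointly equidistributed, written $q_1\sim_{jd}q_2$, if for all nonnegative integers $n,k,\ell$ the number of $\pi\in S_n$ with exactly $k$ occurrences of $q_1$ and $\ell$ occurrences of $q_2$ equals the number of $\pi\in S_n$ with exactly $\ell$ occurrences of $q_1$ and $k$ occurrences of $q_2$. *)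

theory Defs
  imports "HOL-Combinatorics.Permutations"
begin

text \<open>
  The permutation $\pi = \pi_1\cdots\pi_n$ in $S_n$ is a function \<open>\<pi>\<close> with \<open>\<pi> permutes {1..n}\<close>,
  where $\pi_m$ is \<open>\<pi> m\<close>. A mesh pattern is a triple \<open>(k, \<tau>, R)\<close> that carries its length explicitly.
\<close>

type_synonym mesh_pattern = "nat \<times> (nat \<Rightarrow> nat) \<times> (nat \<times> nat) set"

definition is_mesh_pattern :: "mesh_pattern \<Rightarrow> bool" where
  "is_mesh_pattern = (\<lambda>(k, \<tau>, R). \<tau> permutes {1..k} \<and> R \<subseteq> {0..k} \<times> {0..k})"

text \<open>
  An occurrence is given by its list \<open>is\<close> of positions $i_1 < \dots < i_k$. The padded lists \<open>I\<close> and \<open>V\<close>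
  include the boundary conventions, so \<open>I ! a\<close> is $i_a$ and \<open>V ! b\<close> is $v_b$
  for all indices from $0$ to $k+1$.
\<close>

definition is_occurrence :: "mesh_pattern \<Rightarrow> nat \<Rightarrow> (nat \<Rightarrow> nat) \<Rightarrow> nat list \<Rightarrow> bool" where
  "is_occurrence = (\<lambda>(k, \<tau>, R) n \<pi> is.
     length is = k \<and> sorted_wrt (<) is \<and> set is \<subseteq> {1..n} \<and>
     (let I = 0 # is @ [n + 1];
          V = 0 # sort (map \<pi> is) @ [n + 1]
      in (\<forall>a\<in>{1..k}. \<forall>b\<in>{1..k}. \<pi> (I ! a) < \<pi> (I ! b) \<longleftrightarrow> \<tau> a < \<tau> b) \<and>
         (\<forall>(a, b)\<in>R. \<not> (\<exists>m\<in>{1..n}. I ! a < m \<and> m < I ! (a + 1) \<and>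
                                   V ! b < \<pi> m \<and> \<pi> m < V ! (b + 1)))))"

definition occurrences :: "mesh_pattern \<Rightarrow> nat \<Rightarrow> (nat \<Rightarrow> nat) \<Rightarrow> nat" where
  "occurrences q n \<pi> = card {is. is_occurrence q n \<pi> is}"

definition jointly_equidistributed :: "mesh_pattern \<Rightarrow> mesh_pattern \<Rightarrow> bool"
    (infix "\<sim>\<^sub>j\<^sub>d" 50) where
  "q1 \<sim>\<^sub>j\<^sub>d q2 \<longleftrightarrow>
     (\<forall>n k l. card {\<pi>. \<pi> permutes {1..n} \<and> occurrences q1 n \<pi> = k \<and> occurrences q2 n \<pi> = l} =
              card {\<pi>. \<pi> permutes {1..n} \<and> occurrences q1 n \<pi> = l \<and> occurrences q2 n \<pi> = k})"

definition perm123 :: "nat \<Rightarrow> nat" where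
  "perm123 = id"

definition perm132 :: "nat \<Rightarrow> nat" where
  "perm132 = id(2 := 3, 3 := 2)"

lemma one_line_perm123: "map perm123 [1, 2, 3] = [1, 2, 3]"
  by (simp add: perm123_def)

lemma one_line_perm132: "map perm132 [1, 2, 3] = [1, 3, 2]"
  by (simp add: perm132_def)

lemma perm123_permutes: "perm123 permutes {1..3}"
  by (simp add: perm123_def permutes_id)

lemma perm132_permutes: "perm132 permutes {1..3}"
proof -
  have "perm132 = transpose 2 3"
    by (auto simp: perm132_def transpose_def fun_eq_iff)
  moreover have "transpose 2 3 permutes {1..3::nat}"
    by (rule permutes_swap_id) auto
  ultimately show ?thesis
    by simp
qed

lemma is_mesh_pattern_perm123: "R \<subseteq> {0..3} \<times> {0..3} \<Longrightarrow> is_mesh_pattern (3, perm123, R)"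
  using perm123_permutes by (simp add: is_mesh_pattern_def)

lemma is_mesh_pattern_perm132: "R \<subseteq> {0..3} \<times> {0..3} \<Longrightarrow> is_mesh_pattern (3, perm132, R)"
  using perm132_permutes by (simp add: is_mesh_pattern_def)

lemma finite_is_occurrence: "finite {is. is_occurrence q n \<pi> is}"
proof (rule finite_subset)
  show "{is. is_occurrence q n \<pi> is} \<subseteq> {is. set is \<subseteq> {1..n} \<and> length is = fst q}"
    by (auto simp: is_occurrence_def split: prod.splits)
  show "finite {is. set is \<subseteq> {1..n} \<and> length is = fst q}"
    by (rule finite_lists_length_eq) simp
qed

end

theory Submission
  imports Defs
begin

text \<open>
  Since \<open>R'\<close> is the converse of \<open>R\<close> and both 123 and 132 are involutions, the second claim follows
  from the first by inverting permutations.

  For \<open>R\<close>, the shaded row 1 forces the two smallest values of an occurrence to be \<open>v\<close> and \<open>v + 1\<close>, and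
  each pattern has at most one occurrence with smallest value \<open>v\<close>. Exchanging the last two entries
  turns the 123-occurrence at \<open>v\<close> into a 132-occurrence at \<open>v\<close>. Occurrences with different smallest
  values occupy disjoint value intervals, so the exchange changes nothing at other smallest values.
  Let \<open>S\<close> and \<open>T\<close> be the sets of smallest values of 123- and 132-occurrences. With \<open>S - {v}\<close> and
  \<open>T - {v}\<close> prescribed, the exchange is a bijection from the permutations with \<open>v\<close> in \<open>S\<close> to those
  with \<open>v\<close> in \<open>T\<close>. It may map into both sets, but removing from each side the permutations
  with \<open>v\<close> in both leaves equal numbers. Hence \<open>v\<close> may be swapped between \<open>S\<close> and \<open>T\<close>, and doing this for
  every \<open>v\<close> shows that \<open>(S, T)\<close> and \<open>(T, S)\<close> are equally frequent.
\<close>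

section \<open>Explicit triples for occurrences, and inversion of permutations\<close>

text \<open>The shading condition is isolated with both padded lists as parameters, so that
  inversion can interchange the list of positions and the list of values.\<close>

definition avoids_shading ::
  "(nat \<times> nat) set \<Rightarrow> nat \<Rightarrow> (nat \<Rightarrow> nat) \<Rightarrow> nat list \<Rightarrow> nat list \<Rightarrow> bool" where
  "avoids_shading R n \<pi> I V \<longleftrightarrow> (\<forall>(a, b)\<in>R. \<not> (\<exists>m\<in>{1..n}.
     I ! a < m \<and> m < I ! (a + 1) \<and> V ! b < \<pi> m \<and> \<pi> m < V ! (b + 1)))"

text \<open>Inversion reflects the diagram of \<pi> in the main diagonal: the point
  \<open>(m, \<pi> m)\<close> becomes \<open>(\<pi> m, m)\<close> and box \<open>(a, b)\<close>
  becomes box \<open>(b, a)\<close>.\<close>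

lemma avoids_shading_converse:
  assumes "\<pi> permutes {1..n}"
  shows "avoids_shading (R\<inverse>) n \<pi> I V \<longleftrightarrow> avoids_shading R n (inv \<pi>) V I"
proof -
  have "(\<exists>m\<in>{1..n}. P m (\<pi> m)) \<longleftrightarrow> (\<exists>m\<in>{1..n}. P (inv \<pi> m) m)" for P
    using permutes_in_image[OF assms] permutes_in_image[OF permutes_inv[OF assms]]
      permutes_inverses[OF assms] by metis
  from this[of "\<lambda>x y. I ! a < x \<and> x < I ! (a + 1) \<and> V ! b < y \<and> y < V ! (b + 1)" for a b]
  have "(\<exists>m\<in>{1..n}. I ! a < m \<and> m < I ! (a + 1) \<and> V ! b < \<pi> m \<and> \<pi> m < V ! (b + 1)) \<longleftrightarrow>
        (\<exists>m\<in>{1..n}. V ! b < m \<and> m < V ! (b + 1) \<and> I ! a < inv \<pi> m \<and> inv \<pi> m < I ! (a + 1))" for a b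
    by (simp only: conj_ac)
  moreover have "(\<forall>(a, b)\<in>R\<inverse>. P a b) \<longleftrightarrow> (\<forall>(a, b)\<in>R. P b a)" for P
    by auto
  ultimately show ?thesis
    unfolding avoids_shading_def by (simp only:)
qed

lemma list_length_3_conv: "length xs = 3 \<longleftrightarrow> (\<exists>i j k. xs = [i, j, k])"
  by (auto simp: length_Suc_conv numeral_3_eq_3)

lemma atLeastAtMost_1_3: "{1..3::nat} = {1, 2, 3}"
  by auto

lemma is_occurrence_123_iff:
  "is_occurrence (3, perm123, R) n \<pi> is \<longleftrightarrow>
     (\<exists>i j k. is = [i, j, k] \<and> 0 < i \<and> i < j \<and> j < k \<and> k \<le> n \<and> \<pi> i < \<pi> j \<and> \<pi> j < \<pi> k \<and>
        avoids_shading R n \<pi> [0, i, j, k, n + 1] [0, \<pi> i, \<pi> j, \<pi> k, n + 1])"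
  unfolding is_occurrence_def avoids_shading_def Let_def prod.case list_length_3_conv atLeastAtMost_1_3
  by (auto simp: perm123_def)

text \<open>The order type determines the outcome of \<open>sort\<close>: the last two values of a
  132-occurrence are listed in the reverse of their positional order.\<close>

lemma is_occurrence_132_iff:
  "is_occurrence (3, perm132, R) n \<pi> is \<longleftrightarrow>
     (\<exists>i j k. is = [i, j, k] \<and> 0 < i \<and> i < j \<and> j < k \<and> k \<le> n \<and> \<pi> i < \<pi> k \<and> \<pi> k < \<pi> j \<and>
        avoids_shading R n \<pi> [0, i, j, k, n + 1] [0, \<pi> i, \<pi> k, \<pi> j, n + 1])"
  unfolding is_occurrence_def avoids_shading_def Let_def prod.case list_length_3_conv atLeastAtMost_1_3
  by (auto simp: perm132_def)

text \<open>Outside \<open>{1..n}\<close> the permutation is the identity, so the equivalences hold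
  for every \<open>i\<close> and can serve as rewrite rules.\<close>

lemma permutes_interval_bounds:
  fixes \<pi> :: "nat \<Rightarrow> nat"
  assumes "\<pi> permutes {1..n}"
  shows "0 < \<pi> i \<longleftrightarrow> 0 < i" "\<pi> i \<le> n \<longleftrightarrow> i \<le> n"
proof -
  have "(0 < \<pi> i \<longleftrightarrow> 0 < i) \<and> (\<pi> i \<le> n \<longleftrightarrow> i \<le> n)"
  proof (cases "i \<in> {1..n}")
    case True
    then have "\<pi> i \<in> {1..n}"
      using permutes_in_image[OF assms] by blast
    with True show ?thesis by auto
  next
    case False
    then show ?thesis
      using permutes_not_in[OF assms] by simp
  qed
  then show "0 < \<pi> i \<longleftrightarrow> 0 < i" "\<pi> i \<le> n \<longleftrightarrow> i \<le> n"
    by blast+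
qed

lemma occurrences_123_converse:
  assumes "\<pi> permutes {1..n}"
  shows "occurrences (3, perm123, R\<inverse>) n \<pi> = occurrences (3, perm123, R) n (inv \<pi>)"
proof -
  note inv = permutes_inv[OF assms] and pinv = permutes_inverses[OF assms]
  note rng = permutes_interval_bounds[OF assms] permutes_interval_bounds[OF inv]
  have "bij_betw (map \<pi>) {is. is_occurrence (3, perm123, R\<inverse>) n \<pi> is}
     {is. is_occurrence (3, perm123, R) n (inv \<pi>) is}"
    by (rule bij_betw_byWitness[where f' = "map (inv \<pi>)"])
      (auto simp: is_occurrence_123_iff avoids_shading_converse[OF assms] pinv rng)
  then show ?thesis
    unfolding occurrences_def by (rule bij_betw_same_card)
qed

lemma occurrences_132_converse:
  assumes "\<pi> permutes {1..n}"
  shows "occurrences (3, perm132, R\<inverse>) n \<pi> = occurrences (3, perm132, R) n (inv \<pi>)"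
proof -
  note inv = permutes_inv[OF assms] and pinv = permutes_inverses[OF assms]
  note rng = permutes_interval_bounds[OF assms] permutes_interval_bounds[OF inv]
  \<comment> \<open>The values of an occurrence become positions in \<open>inv \<pi>\<close> and
    must be listed increasingly; for 132 this interchanges the last two.\<close>
  have "bij_betw (\<lambda>is. [\<pi> (is ! 0), \<pi> (is ! 2), \<pi> (is ! 1)]) {is. is_occurrence (3, perm132, R\<inverse>) n \<pi> is}
     {is. is_occurrence (3, perm132, R) n (inv \<pi>) is}"
    by (rule bij_betw_byWitness[where f' = "\<lambda>is. [inv \<pi> (is ! 0), inv \<pi> (is ! 2), inv \<pi> (is ! 1)]"])
      (auto simp: is_occurrence_132_iff avoids_shading_converse[OF assms] pinv rng)
  then show ?thesis
    unfolding occurrences_def by (rule bij_betw_same_card)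
qed

lemma jointly_equidistributed_converse:
  assumes "(3, perm123, R) \<sim>\<^sub>j\<^sub>d (3, perm132, R)"
  shows "(3, perm123, R\<inverse>) \<sim>\<^sub>j\<^sub>d (3, perm132, R\<inverse>)"
proof -
  let ?N = "\<lambda>R n k l. {\<pi>. \<pi> permutes {1..n} \<and> occurrences (3, perm123, R) n \<pi> = k \<and>
    occurrences (3, perm132, R) n \<pi> = l}"
  have "bij_betw inv (?N (R\<inverse>) n k l) (?N R n k l)" for n k l
    by (rule bij_betw_byWitness[where f' = inv])
      (auto simp: occurrences_123_converse occurrences_132_converse permutes_inv permutes_inv_inv)
  then have "card (?N (R\<inverse>) n k l) = card (?N R n k l)" for n k l
    by (rule bij_betw_same_card)
  with assms show ?thesis
    unfolding jointly_equidistributed_def by simp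
qed

section \<open>The shading expressed by inequalities\<close>

text \<open>The condition shared by both patterns; it does not distinguish the entries at \<open>j\<close> and \<open>k\<close>, so
  exchanging them turns an occurrence of one pattern into an occurrence of the other.\<close>

definition linked :: "nat \<Rightarrow> (nat \<Rightarrow> nat) \<Rightarrow> nat \<Rightarrow> nat \<Rightarrow> nat \<Rightarrow> bool" where
  "linked n \<pi> i j k \<longleftrightarrow> 0 < i \<and> i < j \<and> j < k \<and> k \<le> n \<and>
     (\<forall>m. 0 < m \<and> m < i \<longrightarrow> \<pi> j < \<pi> m \<and> \<pi> k < \<pi> m) \<and>
     (\<forall>m. j < m \<and> m < k \<longrightarrow> \<pi> m < \<pi> i) \<and>
     (\<forall>m. k < m \<and> m \<le> n \<longrightarrow> \<pi> i + 1 < \<pi> m)"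

definition occ123 :: "nat \<Rightarrow> (nat \<Rightarrow> nat) \<Rightarrow> nat \<Rightarrow> nat \<Rightarrow> nat \<Rightarrow> bool" where
  "occ123 n \<pi> i j k \<longleftrightarrow> linked n \<pi> i j k \<and> \<pi> j = \<pi> i + 1 \<and> \<pi> j < \<pi> k"

definition occ132 :: "nat \<Rightarrow> (nat \<Rightarrow> nat) \<Rightarrow> nat \<Rightarrow> nat \<Rightarrow> nat \<Rightarrow> bool" where
  "occ132 n \<pi> i j k \<longleftrightarrow> linked n \<pi> i j k \<and> \<pi> k = \<pi> i + 1 \<and> \<pi> k < \<pi> j"

abbreviation (input) shading :: "(nat \<times> nat) set" where
  "shading \<equiv> {(0,0), (0,1), (0,2), (3,0), (1,1), (2,1), (2,2), (2,3), (3,1)}"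

text \<open>The empty boxes are read by columns. Column 0 puts entries before \<open>i\<close> above
  \<open>c\<close>, column 2 puts entries between \<open>j\<close> and \<open>k\<close> below
  \<open>\<pi> i\<close>, and column 3 puts entries after \<open>k\<close> above \<open>b\<close>.
  Row 1 is shaded throughout, so no value lies between \<open>\<pi> i\<close> and \<open>b\<close>.
  Naming the sorted values \<open>b\<close>, \<open>c\<close> covers both patterns at once.\<close>

lemma avoids_shading_iff_linked:
  assumes p: "\<pi> permutes {1..n}" and ord: "0 < i" "i < j" "j < k" "k \<le> n"
    and vals: "\<pi> i < b" "b < c" "{b, c} = {\<pi> j, \<pi> k}"
  shows "avoids_shading shading n \<pi> [0, i, j, k, n + 1] [0, \<pi> i, b, c, n + 1] \<longleftrightarrow>
    linked n \<pi> i j k \<and> b = \<pi> i + 1" (is "?L = ?R")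
proof
  have bc: "b = \<pi> j \<and> c = \<pi> k \<or> b = \<pi> k \<and> c = \<pi> j"
    using vals(3) by (auto simp: doubleton_eq_iff)
  assume ?R
  then have cells: "(m < i \<longrightarrow> b < \<pi> m \<and> c < \<pi> m) \<and> (j < m \<and> m < k \<longrightarrow> \<pi> m < \<pi> i) \<and>
    (k < m \<longrightarrow> b < \<pi> m)" and b: "b = \<pi> i + 1" if "0 < m" "m \<le> n" for m
    using bc that by (auto simp: linked_def)
  have "\<not> ([0, i, j, k, n + 1] ! x < m \<and> m < [0, i, j, k, n + 1] ! (x + 1) \<and>
      [0, \<pi> i, b, c, n + 1] ! y < \<pi> m \<and> \<pi> m < [0, \<pi> i, b, c, n + 1] ! (y + 1))"
    if "(x, y) \<in> shading" "m \<in> {1..n}" for x y m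
    using that(1) cells[of m] b[of m] ord vals(1,2) that(2)
    by (elim insertE) (auto simp: eval_nat_numeral)
  then show ?L
    unfolding avoids_shading_def by blast
next
  have bc: "b = \<pi> j \<and> c = \<pi> k \<or> b = \<pi> k \<and> c = \<pi> j"
    using vals(3) by (auto simp: doubleton_eq_iff)
  assume av: ?L
  note rng = permutes_interval_bounds[OF p]
  have ne: "\<pi> x \<noteq> \<pi> y" if "x \<noteq> y" for x y
    using permutes_inj[OF p] that by (auto dest: injD)
  \<comment> \<open>This includes \<open>m = i\<close>, \<open>j\<close>, \<open>k\<close>, so it
    can be applied to a position known only by its value.\<close>
  have cells: "(m < i \<longrightarrow> c < \<pi> m) \<and> \<not> (\<pi> i < \<pi> m \<and> \<pi> m < b) \<and>
    (j < m \<and> m < k \<longrightarrow> \<pi> m < \<pi> i) \<and> (k < m \<longrightarrow> b < \<pi> m)"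
    if m: "0 < m" "m \<le> n" for m
  proof -
    have "\<not> ([0, i, j, k, n + 1] ! x < m \<and> m < [0, i, j, k, n + 1] ! (x + 1) \<and>
      [0, \<pi> i, b, c, n + 1] ! y < \<pi> m \<and> \<pi> m < [0, \<pi> i, b, c, n + 1] ! (y + 1))"
      if "(x, y) \<in> shading" for x y
      using av that m unfolding avoids_shading_def by fastforce
    \<comment> \<open>Sorted by column: facts 1-3 are column 0, fact 4 is column 1, facts 5-7 are
      column 2, facts 8-9 are column 3.\<close>
    note box = this[of 0 0, simplified] this[of 0 1, simplified] this[of 0 2, simplified]
      this[of 1 1, simplified] this[of 2 1, simplified] this[of 2 2, simplified]
      this[of 2 3, simplified] this[of 3 0, simplified] this[of 3 1, simplified]
    have bnd: "0 < \<pi> m" "\<pi> m < n + 1"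
      using rng[of m] m by auto
    have "m \<noteq> i \<longrightarrow> \<pi> m \<noteq> \<pi> i" "m \<noteq> j \<longrightarrow> \<pi> m \<noteq> \<pi> j" "m \<noteq> k \<longrightarrow> \<pi> m \<noteq> \<pi> k"
      using ne by blast+
    with bc have "m = i \<or> m = j \<or> m = k \<or> \<pi> m \<noteq> \<pi> i \<and> \<pi> m \<noteq> b \<and> \<pi> m \<noteq> c"
      by metis
    then consider "m = i" | "m = j" | "m = k"
      | "m \<noteq> i" "m \<noteq> j" "m \<noteq> k" "\<pi> m \<noteq> \<pi> i" "\<pi> m \<noteq> b" "\<pi> m \<noteq> c"
      by blast
    then show ?thesis
    proof cases
      case 4
      have "m < i \<longrightarrow> \<not> \<pi> m < \<pi> i \<and> \<not> (\<pi> i < \<pi> m \<and> \<pi> m < b) \<and> \<not> (b < \<pi> m \<and> \<pi> m < c)"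
        using box(1-3) bnd m by (auto simp: eval_nat_numeral)
      moreover have "i < m \<and> m < j \<longrightarrow> \<not> (\<pi> i < \<pi> m \<and> \<pi> m < b)"
        using box(4) by (auto simp: eval_nat_numeral)
      moreover have "j < m \<and> m < k \<longrightarrow>
          \<not> (\<pi> i < \<pi> m \<and> \<pi> m < b) \<and> \<not> (b < \<pi> m \<and> \<pi> m < c) \<and> \<not> c < \<pi> m"
        using box(5-7) bnd by (auto simp: eval_nat_numeral)
      moreover have "k < m \<longrightarrow> \<not> \<pi> m < \<pi> i \<and> \<not> (\<pi> i < \<pi> m \<and> \<pi> m < b)"
        using box(8,9) bnd m by (auto simp: eval_nat_numeral)
      ultimately have columns: "m < i \<Longrightarrow> c < \<pi> m" "i < m \<Longrightarrow> m < j \<Longrightarrow> \<not> (\<pi> i < \<pi> m \<and> \<pi> m < b)"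
        "j < m \<Longrightarrow> m < k \<Longrightarrow> \<pi> m < \<pi> i" "k < m \<Longrightarrow> b < \<pi> m"
        using 4(4-6) vals(1,2) by (metis linorder_neqE_nat less_trans)+
      consider "m < i" | "i < m" "m < j" | "j < m" "m < k" | "k < m"
        using 4(1-3) by linarith
      then show ?thesis
      proof cases
        case 1 then show ?thesis using columns(1) ord vals(1,2) by simp
      next
        case 2 then show ?thesis using columns(2) ord vals(1,2) by simp
      next
        case 3 then show ?thesis using columns(3) ord vals(1,2) by simp
      next
        case 4 then show ?thesis using columns(4) ord vals(1,2) by simp
      qed
    qed (use ord vals(1,2) bc in auto)
  qed
  have "b = \<pi> i + 1"
  proof (rule ccontr)
    assume "b \<noteq> \<pi> i + 1"
    with vals have "\<pi> i + 1 < b" by simp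
    \<comment> \<open>The value \<open>\<pi> i + 1\<close> is at most \<open>n\<close>, so it is
      attained at a position in \<open>{1..n}\<close>; if it were below \<open>b\<close>, it would
      lie in the empty row 1.\<close>
    moreover define m where "m = inv \<pi> (\<pi> i + 1)"
    then have "\<pi> m = \<pi> i + 1"
      using permutes_inverses[OF p] by simp
    ultimately show False
      using cells[of m] rng[of m] rng[of j] rng[of k] ord bc by auto
  qed
  moreover have "(0 < m \<and> m < i \<longrightarrow> \<pi> j < \<pi> m \<and> \<pi> k < \<pi> m) \<and> (j < m \<and> m < k \<longrightarrow> \<pi> m < \<pi> i) \<and>
      (k < m \<and> m \<le> n \<longrightarrow> \<pi> i + 1 < \<pi> m)" for m
    using cells[of m] ord bc vals(2) \<open>b = \<pi> i + 1\<close> by auto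
  then have "linked n \<pi> i j k"
    unfolding linked_def using ord by blast
  ultimately show ?R
    by blast
qed

lemma is_occurrence_123_shading_iff:
  assumes "\<pi> permutes {1..n}"
  shows "is_occurrence (3, perm123, shading) n \<pi> is \<longleftrightarrow>
    (\<exists>i j k. is = [i, j, k] \<and> occ123 n \<pi> i j k)"
proof -
  have "0 < i \<and> i < j \<and> j < k \<and> k \<le> n \<and> \<pi> i < \<pi> j \<and> \<pi> j < \<pi> k \<and>
      avoids_shading shading n \<pi> [0, i, j, k, n + 1] [0, \<pi> i, \<pi> j, \<pi> k, n + 1] \<longleftrightarrow> occ123 n \<pi> i j k"
    for i j k
  proof (cases "0 < i \<and> i < j \<and> j < k \<and> k \<le> n \<and> \<pi> i < \<pi> j \<and> \<pi> j < \<pi> k")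
    case True
    then have "avoids_shading shading n \<pi> [0, i, j, k, n + 1] [0, \<pi> i, \<pi> j, \<pi> k, n + 1] \<longleftrightarrow>
        linked n \<pi> i j k \<and> \<pi> j = \<pi> i + 1"
      by (intro avoids_shading_iff_linked[OF assms]) auto
    with True show ?thesis
      by (simp only: occ123_def) simp
  next
    case False
    then show ?thesis
      by (auto simp: occ123_def linked_def)
  qed
  then show ?thesis
    unfolding is_occurrence_123_iff by simp
qed

lemma is_occurrence_132_shading_iff:
  assumes "\<pi> permutes {1..n}"
  shows "is_occurrence (3, perm132, shading) n \<pi> is \<longleftrightarrow>
    (\<exists>i j k. is = [i, j, k] \<and> occ132 n \<pi> i j k)"
proof -
  have "0 < i \<and> i < j \<and> j < k \<and> k \<le> n \<and> \<pi> i < \<pi> k \<and> \<pi> k < \<pi> j \<and>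
      avoids_shading shading n \<pi> [0, i, j, k, n + 1] [0, \<pi> i, \<pi> k, \<pi> j, n + 1] \<longleftrightarrow> occ132 n \<pi> i j k"
    for i j k
  proof (cases "0 < i \<and> i < j \<and> j < k \<and> k \<le> n \<and> \<pi> i < \<pi> k \<and> \<pi> k < \<pi> j")
    case True
    then have "avoids_shading shading n \<pi> [0, i, j, k, n + 1] [0, \<pi> i, \<pi> k, \<pi> j, n + 1] \<longleftrightarrow>
        linked n \<pi> i j k \<and> \<pi> k = \<pi> i + 1"
      by (intro avoids_shading_iff_linked[OF assms]) auto
    with True show ?thesis
      by (simp only: occ132_def) simp
  next
    case False
    then show ?thesis
      by (auto simp: occ132_def linked_def)
  qed
  then show ?thesis
    unfolding is_occurrence_132_iff by simp
qed

section \<open>Smallest values of occurrences and the exchange of the last two entries\<close>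

definition lows123 :: "nat \<Rightarrow> (nat \<Rightarrow> nat) \<Rightarrow> nat set" where
  "lows123 n \<pi> = {\<pi> i |i j k. occ123 n \<pi> i j k}"

definition lows132 :: "nat \<Rightarrow> (nat \<Rightarrow> nat) \<Rightarrow> nat set" where
  "lows132 n \<pi> = {\<pi> i |i j k. occ132 n \<pi> i j k}"

lemma mem_lows123: "v \<in> lows123 n \<pi> \<longleftrightarrow> (\<exists>i j k. occ123 n \<pi> i j k \<and> \<pi> i = v)"
  by (auto simp: lows123_def)

text \<open>The values \<open>\<pi> i\<close> and \<open>\<pi> i + 1\<close> fix \<open>i\<close>
  and \<open>j\<close>. Of two candidates \<open>x < y\<close> for the third position,
  \<open>x\<close> lies between \<open>j\<close> and \<open>y\<close>, which forces
  \<open>\<pi> x < \<pi> i\<close>, although \<open>x\<close> ends a 123-occurrence.\<close>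

lemma occ123_unique:
  assumes "inj \<pi>" "occ123 n \<pi> i j k" "occ123 n \<pi> i' j' k'" "\<pi> i = \<pi> i'"
  shows "i = i' \<and> j = j' \<and> k = k'"
proof -
  have ij: "i = i'" "j = j'"
    using assms(2-4) injD[OF assms(1)] by (simp_all add: occ123_def)
  have less: False if "occ123 n \<pi> i j x" "occ123 n \<pi> i j y" "x < y" for x y
  proof -
    have "\<pi> x < \<pi> i" "\<pi> i < \<pi> x"
      using that by (auto simp: occ123_def linked_def)
    then show False by simp
  qed
  have "occ123 n \<pi> i j k" "occ123 n \<pi> i j k'"
    using assms(2,3) ij by simp_all
  then have "k = k'"
    by (cases k k' rule: linorder_cases) (auto dest: less)
  with ij show ?thesis
    by simp
qed

lemma mem_lows132: "v \<in> lows132 n \<pi> \<longleftrightarrow> (\<exists>i j k. occ132 n \<pi> i j k \<and> \<pi> i = v)"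
  by (auto simp: lows132_def)

text \<open>Here the value \<open>\<pi> i + 1\<close> fixes \<open>k\<close>. Of two candidates
  \<open>x < y\<close> for the middle position, \<open>y\<close> lies between \<open>x\<close> and
  \<open>k\<close> and would have a value below \<open>\<pi> i\<close>.\<close>

lemma occ132_unique:
  assumes "inj \<pi>" "occ132 n \<pi> i j k" "occ132 n \<pi> i' j' k'" "\<pi> i = \<pi> i'"
  shows "i = i' \<and> j = j' \<and> k = k'"
proof -
  have ij: "i = i'" "k = k'"
    using assms(2-4) injD[OF assms(1)] by (simp_all add: occ132_def)
  have less: False if "occ132 n \<pi> i x k" "occ132 n \<pi> i y k" "x < y" for x y
  proof -
    have y: "y < k" "\<pi> i < \<pi> y"
      using that(2) by (simp_all add: occ132_def linked_def)
    have "\<pi> y < \<pi> i"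
      using that(1,3) y(1) by (simp add: occ132_def linked_def)
    with y(2) show False by simp
  qed
  have "occ132 n \<pi> i j k" "occ132 n \<pi> i j' k"
    using assms(2,3) ij by simp_all
  then have "j = j'"
    by (cases j j' rule: linorder_cases) (auto dest: less)
  with ij show ?thesis
    by simp
qed

text \<open>The ranges of \<open>m\<close> in \<open>linked\<close> avoid \<open>j\<close> and
  \<open>k\<close>, and the values at these two positions enter only symmetrically.\<close>

lemma linked_transpose:
  "linked n (\<pi> \<circ> transpose j k) i j k \<longleftrightarrow> linked n \<pi> i j k"
  unfolding linked_def by (auto simp: transpose_def)

lemma occ132_transpose: "occ132 n (\<pi> \<circ> transpose j k) i j k \<longleftrightarrow> occ123 n \<pi> i j k"
  unfolding occ132_def occ123_def linked_transpose
  by (auto simp: transpose_def linked_def)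

lemma occ123_transpose: "occ123 n (\<pi> \<circ> transpose j k) i j k \<longleftrightarrow> occ132 n \<pi> i j k"
  unfolding occ132_def occ123_def linked_transpose
  by (auto simp: transpose_def linked_def)

text \<open>The triple with the larger smallest value must start first: an entry before
  \<open>i\<close> exceeds \<open>\<pi> j\<close> and hence \<open>\<pi> i\<close>, so
  \<open>i' < i\<close> is impossible. Then \<open>i\<close> precedes \<open>i'\<close>, and
  \<open>linked\<close> puts \<open>\<pi> i\<close> above both \<open>\<pi> j'\<close> and
  \<open>\<pi> k'\<close>.\<close>

lemma occ_separated:
  assumes "occ123 n \<pi> i j k \<or> occ132 n \<pi> i j k" "occ123 n \<pi> i' j' k' \<or> occ132 n \<pi> i' j' k'"
    and "\<pi> i' < \<pi> i"
  shows "\<pi> j' < \<pi> i \<and> \<pi> k' < \<pi> i \<and> \<pi> i < \<pi> j \<and> \<pi> i < \<pi> k \<and> \<pi> i' < \<pi> j' \<and> \<pi> i' < \<pi> k'"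
proof -
  have "\<pi> i < \<pi> j" "\<pi> i < \<pi> k" "\<pi> i' < \<pi> j'" "\<pi> i' < \<pi> k'"
    using assms(1,2) by (auto simp: occ123_def occ132_def)
  moreover have "\<not> i' < i"
  proof
    assume "i' < i"
    then have "\<pi> j < \<pi> i'"
      using assms(1,2) by (auto simp: occ123_def occ132_def linked_def)
    with calculation assms(3) show False by simp
  qed
  then have "i < i'"
    using assms(3) by (cases "i = i'") auto
  then have "\<pi> j' < \<pi> i \<and> \<pi> k' < \<pi> i"
    using assms by (auto simp: occ123_def occ132_def linked_def)
  ultimately show ?thesis
    by blast
qed

text \<open>By separation, \<open>\<pi> j\<close> and \<open>\<pi> k\<close> lie on the same side of
  every value with which the other triple compares its surroundings, so exchanging them alters no
  comparison.\<close>

lemma occ_transpose_other: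
  assumes o: "occ123 n \<pi> i j k \<or> occ132 n \<pi> i j k" and o': "occ123 n \<pi> i' j' k' \<or> occ132 n \<pi> i' j' k'"
    and ne: "\<pi> i' \<noteq> \<pi> i" and \<sigma>: "\<sigma> = \<pi> \<circ> transpose j k"
  shows "\<sigma> i' = \<pi> i'" "occ123 n \<sigma> i' j' k' \<longleftrightarrow> occ123 n \<pi> i' j' k'"
    "occ132 n \<sigma> i' j' k' \<longleftrightarrow> occ132 n \<pi> i' j' k'"
proof -
  \<comment> \<open>The bounds on \<open>\<pi> i' + 1\<close> follow from
    \<open>\<pi> i' < \<pi> j' < \<pi> i\<close>; they serve the condition on entries after
    \<open>k'\<close>.\<close>
  have sep: "\<pi> i' < \<pi> i \<and> \<pi> i' < \<pi> j \<and> \<pi> i' < \<pi> k \<and> \<pi> j' < \<pi> j \<and> \<pi> j' < \<pi> k \<and> \<pi> k' < \<pi> j \<and> \<pi> k' < \<pi> k \<and>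
      \<pi> i' + 1 < \<pi> j \<and> \<pi> i' + 1 < \<pi> k \<or>
    \<pi> j < \<pi> i' \<and> \<pi> k < \<pi> i' \<and> \<pi> j < \<pi> j' \<and> \<pi> k < \<pi> j' \<and> \<pi> j < \<pi> k' \<and> \<pi> k < \<pi> k'"
    using occ_separated[OF o o'] occ_separated[OF o' o] ne by linarith
  have l: "linked n \<pi> i j k" "linked n \<pi> i' j' k'"
    using o o' by (auto simp: occ123_def occ132_def)
  have "i' \<noteq> j" "i' \<noteq> k" "j' \<noteq> j" "j' \<noteq> k" "k' \<noteq> j" "k' \<noteq> k"
    using sep by auto
  then have eq: "\<sigma> i' = \<pi> i'" "\<sigma> j' = \<pi> j'" "\<sigma> k' = \<pi> k'"
    by (auto simp: \<sigma> transpose_def)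
  moreover have "linked n \<sigma> i' j' k'"
  proof -
    have jk: "0 < j" "0 < k" "j \<le> n" "k \<le> n"
      using l by (auto simp: linked_def)
    have \<sigma>m: "\<sigma> m = (if m = j then \<pi> k else if m = k then \<pi> j else \<pi> m)" for m
      by (simp add: \<sigma> transpose_def)
    have "(0 < m \<and> m < i' \<longrightarrow> \<pi> j' < \<sigma> m \<and> \<pi> k' < \<sigma> m) \<and> (j' < m \<and> m < k' \<longrightarrow> \<sigma> m < \<pi> i') \<and>
      (k' < m \<and> m \<le> n \<longrightarrow> \<pi> i' + 1 < \<sigma> m)" for m
    proof -
      have cells: "(0 < m \<and> m < i' \<longrightarrow> \<pi> j' < \<pi> m \<and> \<pi> k' < \<pi> m) \<and> (j' < m \<and> m < k' \<longrightarrow> \<pi> m < \<pi> i') \<and>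
        (k' < m \<and> m \<le> n \<longrightarrow> \<pi> i' + 1 < \<pi> m)" for m
        using l(2) by (simp add: linked_def)
      consider "m = j" "\<sigma> m = \<pi> k" | "m = k" "\<sigma> m = \<pi> j" | "\<sigma> m = \<pi> m"
        using \<sigma>m by metis
      then show ?thesis
      proof cases
        case 1
        then show ?thesis using sep cells[of j] jk by (elim disjE) auto
      next
        case 2
        then show ?thesis using sep cells[of k] jk by (elim disjE) auto
      next
        case 3
        then show ?thesis using cells[of m] by simp
      qed
    qed
    moreover have "0 < i' \<and> i' < j' \<and> j' < k' \<and> k' \<le> n"
      using l(2) by (simp add: linked_def)
    ultimately show ?thesis
      unfolding linked_def eq by blast
  qed
  ultimately show "\<sigma> i' = \<pi> i'" "occ123 n \<sigma> i' j' k' \<longleftrightarrow> occ123 n \<pi> i' j' k'"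
    "occ132 n \<sigma> i' j' k' \<longleftrightarrow> occ132 n \<pi> i' j' k'"
    using l(2) by (simp_all add: occ123_def occ132_def)
qed

lemma lows_transpose_subset:
  assumes o: "occ123 n \<pi> i j k \<or> occ132 n \<pi> i j k"
  shows "lows123 n \<pi> - {\<pi> i} \<subseteq> lows123 n (\<pi> \<circ> transpose j k)"
    and "lows132 n \<pi> - {\<pi> i} \<subseteq> lows132 n (\<pi> \<circ> transpose j k)"
proof -
  have "\<pi> i' \<in> lows123 n (\<pi> \<circ> transpose j k)" if "occ123 n \<pi> i' j' k'" "\<pi> i' \<noteq> \<pi> i" for i' j' k'
    using occ_transpose_other[OF o disjI1[OF that(1)] that(2) refl] that(1)
    unfolding lows123_def by (metis (mono_tags, lifting) mem_Collect_eq)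
  then show "lows123 n \<pi> - {\<pi> i} \<subseteq> lows123 n (\<pi> \<circ> transpose j k)"
    unfolding lows123_def[of n \<pi>] by blast
  have "\<pi> i' \<in> lows132 n (\<pi> \<circ> transpose j k)" if "occ132 n \<pi> i' j' k'" "\<pi> i' \<noteq> \<pi> i" for i' j' k'
    using occ_transpose_other[OF o disjI2[OF that(1)] that(2) refl] that(1)
    unfolding lows132_def by (metis (mono_tags, lifting) mem_Collect_eq)
  then show "lows132 n \<pi> - {\<pi> i} \<subseteq> lows132 n (\<pi> \<circ> transpose j k)"
    unfolding lows132_def[of n \<pi>] by blast
qed

text \<open>The exchange is an involution that keeps \<open>\<pi> i\<close>, so the inclusions for
  \<pi> and for its image give equality.\<close>

lemma lows_transpose:
  assumes o: "occ123 n \<pi> i j k \<or> occ132 n \<pi> i j k"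
  shows "lows123 n (\<pi> \<circ> transpose j k) - {\<pi> i} = lows123 n \<pi> - {\<pi> i}"
    and "lows132 n (\<pi> \<circ> transpose j k) - {\<pi> i} = lows132 n \<pi> - {\<pi> i}"
proof -
  let ?\<sigma> = "\<pi> \<circ> transpose j k"
  have o': "occ123 n ?\<sigma> i j k \<or> occ132 n ?\<sigma> i j k"
    using o by (auto simp: occ123_transpose occ132_transpose)
  have "i \<noteq> j" "i \<noteq> k"
    using o by (auto simp: occ123_def occ132_def linked_def)
  then have "?\<sigma> i = \<pi> i" "?\<sigma> \<circ> transpose j k = \<pi>"
    by (simp_all add: comp_assoc)
  then show "lows123 n ?\<sigma> - {\<pi> i} = lows123 n \<pi> - {\<pi> i}" "lows132 n ?\<sigma> - {\<pi> i} = lows132 n \<pi> - {\<pi> i}"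
    using lows_transpose_subset[OF o] lows_transpose_subset[OF o'] by auto
qed

section \<open>Counting permutations by their pairs of sets of smallest values\<close>

lemma card_profile_with_low:
  "card {\<pi>. \<pi> permutes {1..n} \<and> v \<in> lows123 n \<pi> \<and> lows123 n \<pi> - {v} = S \<and> lows132 n \<pi> - {v} = T} =
   card {\<pi>. \<pi> permutes {1..n} \<and> v \<in> lows132 n \<pi> \<and> lows123 n \<pi> - {v} = S \<and> lows132 n \<pi> - {v} = T}"
  (is "card ?A = card ?B")
proof -
  let ?P = "\<lambda>\<pi>. \<pi> permutes {1..n} \<and> lows123 n \<pi> - {v} = S \<and> lows132 n \<pi> - {v} = T"
  \<comment> \<open>Each permutation carries its triple, because the exchange depends on
    \<open>j\<close> and \<open>k\<close>. Uniqueness of the triple for \<open>v\<close> makes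
    \<open>fst\<close> injective, so the cardinalities are those of the two sets in the
    statement.\<close>
  let ?F = "{(\<pi>, i, j, k). ?P \<pi> \<and> occ123 n \<pi> i j k \<and> \<pi> i = v}"
  let ?G = "{(\<pi>, i, j, k). ?P \<pi> \<and> occ132 n \<pi> i j k \<and> \<pi> i = v}"
  let ?f = "\<lambda>(\<pi> :: nat \<Rightarrow> nat, i :: nat, j, k). (\<pi> \<circ> transpose j k, i, j, k)"
  have perm: "(\<pi> \<circ> transpose j k) permutes {1..n} \<and> (\<pi> \<circ> transpose j k) i = \<pi> i"
    if "\<pi> permutes {1..n}" "occ123 n \<pi> i j k \<or> occ132 n \<pi> i j k" for \<pi> i j k
  proof -
    have "i \<noteq> j" "i \<noteq> k" "j \<in> {1..n}" "k \<in> {1..n}"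
      using that(2) by (auto simp: occ123_def occ132_def linked_def)
    with that(1) show ?thesis
      by (simp add: permutes_compose permutes_swap_id)
  qed
  have P: "?P (\<pi> \<circ> transpose j k) \<and> (\<pi> \<circ> transpose j k) i = v"
    if "?P \<pi>" "occ123 n \<pi> i j k \<or> occ132 n \<pi> i j k" "\<pi> i = v" for \<pi> i j k
    using perm[of \<pi> i j k] lows_transpose[of n \<pi> i j k] that by simp
  have fst_image: "fst ` {(x, i, j, k). Q x i j k} = {x. \<exists>i j k. Q x i j k}"
    for Q :: "'x \<Rightarrow> nat \<Rightarrow> nat \<Rightarrow> nat \<Rightarrow> bool"
    by force
  have "bij_betw ?f ?F ?G"
  proof (rule bij_betw_byWitness[where f' = ?f])
    show "?f ` ?F \<subseteq> ?G"
    proof (rule image_subsetI)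
      fix x assume x: "x \<in> ?F"
      obtain \<pi> i j k where "x = (\<pi>, i, j, k)"
        by (rule prod_cases4)
      with x P[of \<pi> i j k] show "?f x \<in> ?G"
        by (simp add: occ132_transpose)
    qed
    show "?f ` ?G \<subseteq> ?F"
    proof (rule image_subsetI)
      fix x assume x: "x \<in> ?G"
      obtain \<pi> i j k where "x = (\<pi>, i, j, k)"
        by (rule prod_cases4)
      with x P[of \<pi> i j k] show "?f x \<in> ?F"
        by (simp add: occ123_transpose)
    qed
  qed (auto simp: comp_assoc)
  then have "card ?F = card ?G"
    by (rule bij_betw_same_card)
  moreover have "card (fst ` ?F) = card ?F"
  proof (rule card_image, rule inj_onI)
    fix x y assume xy: "x \<in> ?F" "y \<in> ?F" "fst x = fst y"
    obtain \<pi> i j k \<pi>' i' j' k' where "x = (\<pi>, i, j, k)" "y = (\<pi>', i', j', k')"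
      by (metis prod_cases4)
    with xy occ123_unique[OF permutes_inj, of \<pi> "{1..n}" n i j k i' j' k'] show "x = y"
      by simp
  qed
  moreover have "card (fst ` ?G) = card ?G"
  proof (rule card_image, rule inj_onI)
    fix x y assume xy: "x \<in> ?G" "y \<in> ?G" "fst x = fst y"
    obtain \<pi> i j k \<pi>' i' j' k' where "x = (\<pi>, i, j, k)" "y = (\<pi>', i', j', k')"
      by (metis prod_cases4)
    with xy occ132_unique[OF permutes_inj, of \<pi> "{1..n}" n i j k i' j' k'] show "x = y"
      by simp
  qed
  moreover have "fst ` ?F = ?A"
    unfolding fst_image mem_lows123 by blast
  moreover have "fst ` ?G = ?B"
    unfolding fst_image mem_lows132 by blast
  ultimately show ?thesis
    by simp
qed

text \<open>The hypothesis \<open>move\<close> yields the transfer of a single element between the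
  two sets; repeating it over all of \<open>V\<close> interchanges them completely.\<close>

lemma card_profile_exchange:
  fixes F G :: "'a \<Rightarrow> 'v set"
  assumes fin: "finite X"
    and move: "\<And>v S T. card {x \<in> X. v \<in> F x \<and> F x - {v} = S \<and> G x - {v} = T} =
      card {x \<in> X. v \<in> G x \<and> F x - {v} = S \<and> G x - {v} = T}"
    and V: "finite V" "\<And>x. x \<in> X \<Longrightarrow> F x \<subseteq> V \<and> G x \<subseteq> V"
  shows "card {x \<in> X. F x = S \<and> G x = T} = card {x \<in> X. F x = T \<and> G x = S}"
proof -
  let ?N = "\<lambda>S T. {x \<in> X. F x = S \<and> G x = T}"
  have one: "card (?N (insert v S) T) = card (?N S (insert v T))" if "v \<notin> S" "v \<notin> T" for v S T
  proof -
    \<comment> \<open>These elements are counted on both sides of \<open>move\<close> and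
      cancel.\<close>
    let ?B = "?N (insert v S) (insert v T)"
    have "{x \<in> X. v \<in> F x \<and> F x - {v} = S \<and> G x - {v} = T} = ?N (insert v S) T \<union> ?B"
      "{x \<in> X. v \<in> G x \<and> F x - {v} = S \<and> G x - {v} = T} = ?N S (insert v T) \<union> ?B"
      using that by auto
    moreover have "?N (insert v S) T \<inter> ?B = {}" "?N S (insert v T) \<inter> ?B = {}"
      using that by auto
    ultimately show ?thesis
      using move[of v S T] fin by (simp add: card_Un_disjoint)
  qed
  have one': "card (?N A B) = card (?N A' B')"
    if "A = insert v A'" "B' = insert v B" "v \<notin> A'" "v \<notin> B" for v A B A' B'
    using one[OF that(3,4)] that(1,2) by simp
  \<comment> \<open>The two sets are interchanged on \<open>D\<close> only. A new element of
    \<open>D\<close> matters just when it lies in exactly one of \<open>S\<close> and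
    \<open>T\<close>; then it is transferred by \<open>one'\<close>.\<close>
  have swap: "card (?N S T) = card (?N ((S - D) \<union> (T \<inter> D)) ((T - D) \<union> (S \<inter> D)))" if "finite D" for D
    using that
  proof (induction D)
    case (insert v D)
    let ?S = "(S - D) \<union> (T \<inter> D)" and ?T = "(T - D) \<union> (S \<inter> D)"
    let ?S' = "(S - insert v D) \<union> (T \<inter> insert v D)" and ?T' = "(T - insert v D) \<union> (S \<inter> insert v D)"
    consider "v \<in> S \<longleftrightarrow> v \<in> T" | "v \<in> S" "v \<notin> T" | "v \<notin> S" "v \<in> T"
      by blast
    then have "card (?N ?S ?T) = card (?N ?S' ?T')"
    proof cases
      case 1
      then have "?S' = ?S" "?T' = ?T" by auto
      then show ?thesis by simp
    next
      case 2
      with insert.hyps have "?S = insert v ?S'" "?T' = insert v ?T" "v \<notin> ?S'" "v \<notin> ?T" by auto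
      then show ?thesis by (rule one')
    next
      case 3
      with insert.hyps have "?S' = insert v ?S" "?T = insert v ?T'" "v \<notin> ?S" "v \<notin> ?T'" by auto
      then show ?thesis by (rule one'[symmetric])
    qed
    with insert.IH show ?case by simp
  qed simp
  show ?thesis
  proof (cases "S \<subseteq> V \<and> T \<subseteq> V")
    case True
    then have "(S - V) \<union> (T \<inter> V) = T" "(T - V) \<union> (S \<inter> V) = S" by auto
    with swap[OF V(1)] show ?thesis by simp
  next
    case False
    then have "?N S T = {}" "?N T S = {}" using V(2) by auto
    then show ?thesis by (simp only:)
  qed
qed

text \<open>Both counts are sums over pairs of subsets of \<open>V\<close> with prescribed sizes,
  and \<open>prod.swap\<close> matches the index sets while \<open>prof\<close> matches the
  summands.\<close>

lemma card_joint_exchange: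
  fixes F G :: "'a \<Rightarrow> 'v set"
  assumes fin: "finite X"
    and prof: "\<And>S T. card {x \<in> X. F x = S \<and> G x = T} = card {x \<in> X. F x = T \<and> G x = S}"
    and V: "finite V" "\<And>x. x \<in> X \<Longrightarrow> F x \<subseteq> V \<and> G x \<subseteq> V"
  shows "card {x \<in> X. card (F x) = k \<and> card (G x) = l} = card {x \<in> X. card (F x) = l \<and> card (G x) = k}"
proof -
  let ?I = "\<lambda>k l. {(S, T). S \<subseteq> V \<and> T \<subseteq> V \<and> card S = k \<and> card T = l}"
  let ?N = "\<lambda>p. card {x \<in> X. F x = fst p \<and> G x = snd p}"
  have sum: "card {x \<in> X. card (F x) = k \<and> card (G x) = l} = sum ?N (?I k l)" for k l
  proof -
    have "finite (?I k l)"
      by (rule finite_subset[of _ "Pow V \<times> Pow V"]) (use V(1) in auto)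
    moreover have "{x \<in> X. card (F x) = k \<and> card (G x) = l} =
        (\<Union>p\<in>?I k l. {x \<in> X. F x = fst p \<and> G x = snd p})"
      using V(2) by auto
    ultimately show ?thesis
      using fin by (simp only:) (rule card_UN_disjoint; auto)
  qed
  have "sum ?N (?I k l) = sum ?N (?I l k)"
    by (rule sum.reindex_bij_witness[where i = prod.swap and j = prod.swap]) (auto simp: prof)
  with sum show ?thesis by simp
qed

section \<open>Occurrence numbers as sizes of sets of smallest values, and the conclusion\<close>

text \<open>By uniqueness an occurrence is determined by its smallest value, which for both patterns
  is its first entry \<open>\<pi> (hd is)\<close>.\<close>

lemma occurrences_123_shading:
  assumes p: "\<pi> permutes {1..n}"
  shows "occurrences (3, perm123, shading) n \<pi> = card (lows123 n \<pi>)"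
proof -
  let ?O = "{is. is_occurrence (3, perm123, shading) n \<pi> is}"
  have O: "?O = {[i, j, k] |i j k. occ123 n \<pi> i j k}"
    using is_occurrence_123_shading_iff[OF p] by blast
  have "inj_on (\<lambda>is. \<pi> (hd is)) ?O"
  proof (rule inj_onI)
    fix xs ys assume xy: "xs \<in> ?O" "ys \<in> ?O" "\<pi> (hd xs) = \<pi> (hd ys)"
    then obtain i j k i' j' k' where "xs = [i, j, k]" "ys = [i', j', k']"
      "occ123 n \<pi> i j k" "occ123 n \<pi> i' j' k'"
      unfolding O by blast
    with xy(3) occ123_unique[OF permutes_inj[OF p], of n i j k i' j' k'] show "xs = ys"
      by simp
  qed
  moreover have "(\<lambda>is. \<pi> (hd is)) ` ?O = lows123 n \<pi>"
  proof
    show "(\<lambda>is. \<pi> (hd is)) ` ?O \<subseteq> lows123 n \<pi>"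
      unfolding O by (clarsimp simp: mem_lows123) blast
    show "lows123 n \<pi> \<subseteq> (\<lambda>is. \<pi> (hd is)) ` ?O"
    proof
      fix v assume "v \<in> lows123 n \<pi>"
      then obtain i j k where "occ123 n \<pi> i j k" "\<pi> i = v"
        unfolding mem_lows123 by blast
      then show "v \<in> (\<lambda>is. \<pi> (hd is)) ` ?O"
        unfolding O by (intro image_eqI[of _ _ "[i, j, k]"]) auto
    qed
  qed
  ultimately show ?thesis
    unfolding occurrences_def by (metis (no_types, lifting) card_image)
qed

lemma occurrences_132_shading:
  assumes p: "\<pi> permutes {1..n}"
  shows "occurrences (3, perm132, shading) n \<pi> = card (lows132 n \<pi>)"
proof -
  let ?O = "{is. is_occurrence (3, perm132, shading) n \<pi> is}"
  have O: "?O = {[i, j, k] |i j k. occ132 n \<pi> i j k}"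
    using is_occurrence_132_shading_iff[OF p] by blast
  have "inj_on (\<lambda>is. \<pi> (hd is)) ?O"
  proof (rule inj_onI)
    fix xs ys assume xy: "xs \<in> ?O" "ys \<in> ?O" "\<pi> (hd xs) = \<pi> (hd ys)"
    then obtain i j k i' j' k' where "xs = [i, j, k]" "ys = [i', j', k']"
      "occ132 n \<pi> i j k" "occ132 n \<pi> i' j' k'"
      unfolding O by blast
    with xy(3) occ132_unique[OF permutes_inj[OF p], of n i j k i' j' k'] show "xs = ys"
      by simp
  qed
  moreover have "(\<lambda>is. \<pi> (hd is)) ` ?O = lows132 n \<pi>"
  proof
    show "(\<lambda>is. \<pi> (hd is)) ` ?O \<subseteq> lows132 n \<pi>"
      unfolding O by (clarsimp simp: mem_lows132) blast
    show "lows132 n \<pi> \<subseteq> (\<lambda>is. \<pi> (hd is)) ` ?O"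
    proof
      fix v assume "v \<in> lows132 n \<pi>"
      then obtain i j k where "occ132 n \<pi> i j k" "\<pi> i = v"
        unfolding mem_lows132 by blast
      then show "v \<in> (\<lambda>is. \<pi> (hd is)) ` ?O"
        unfolding O by (intro image_eqI[of _ _ "[i, j, k]"]) auto
    qed
  qed
  ultimately show ?thesis
    unfolding occurrences_def by (metis (no_types, lifting) card_image)
qed

lemma lows_subset:
  assumes "\<pi> permutes {1..n}"
  shows "lows123 n \<pi> \<subseteq> {1..n} \<and> lows132 n \<pi> \<subseteq> {1..n}"
proof -
  have "\<pi> i \<in> {1..n}" if "linked n \<pi> i j k" for i j k
    using that permutes_in_image[OF assms, of i] by (simp add: linked_def)
  then show ?thesis
    unfolding lows123_def lows132_def occ123_def occ132_def by blast
qed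

lemma jointly_equidistributed_shading: "(3, perm123, shading) \<sim>\<^sub>j\<^sub>d (3, perm132, shading)"
  unfolding jointly_equidistributed_def
proof (intro allI)
  fix n k l :: nat
  let ?X = "{\<pi>. \<pi> permutes {1..n}}"
  have fin: "finite ?X"
    by (rule finite_permutations) simp
  have sub: "lows123 n \<pi> \<subseteq> {1..n} \<and> lows132 n \<pi> \<subseteq> {1..n}" if "\<pi> \<in> ?X" for \<pi>
    using that lows_subset by blast
  have move: "card {\<pi> \<in> ?X. v \<in> lows123 n \<pi> \<and> lows123 n \<pi> - {v} = S \<and> lows132 n \<pi> - {v} = T} =
      card {\<pi> \<in> ?X. v \<in> lows132 n \<pi> \<and> lows123 n \<pi> - {v} = S \<and> lows132 n \<pi> - {v} = T}" for v S T
    unfolding mem_Collect_eq by (rule card_profile_with_low)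
  have swap: "card {\<pi> \<in> ?X. card (lows123 n \<pi>) = k \<and> card (lows132 n \<pi>) = l} =
      card {\<pi> \<in> ?X. card (lows123 n \<pi>) = l \<and> card (lows132 n \<pi>) = k}"
    by (rule card_joint_exchange[OF fin card_profile_exchange[OF fin move finite_atLeastAtMost sub]
          finite_atLeastAtMost sub])
  have "{\<pi>. \<pi> permutes {1..n} \<and> occurrences (3, perm123, shading) n \<pi> = k \<and>
        occurrences (3, perm132, shading) n \<pi> = l} =
      {\<pi> \<in> ?X. card (lows123 n \<pi>) = k \<and> card (lows132 n \<pi>) = l}" for k l
    using occurrences_123_shading[of _ n] occurrences_132_shading[of _ n] by auto
  with swap show "card {\<pi>. \<pi> permutes {1..n} \<and> occurrences (3, perm123, shading) n \<pi> = k \<and>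
        occurrences (3, perm132, shading) n \<pi> = l} =
      card {\<pi>. \<pi> permutes {1..n} \<and> occurrences (3, perm123, shading) n \<pi> = l \<and>
        occurrences (3, perm132, shading) n \<pi> = k}"
    by (simp only:)
qed

theorem theorem3p1:
  fixes R R' :: "(nat \<times> nat) set"
  assumes R: "R = {(0,0), (0,1), (0,2), (3,0), (1,1), (2,1), (2,2), (2,3), (3,1)}"
    and R': "R' = {(0,0), (1,0), (2,0), (0,3), (1,1), (1,2), (1,3), (2,2), (3,2)}"
  shows "(3, perm123, R) \<sim>\<^sub>j\<^sub>d (3, perm132, R) \<and> (3, perm123, R') \<sim>\<^sub>j\<^sub>d (3, perm132, R')"
proof -
  have R'_eq: "R' = R\<inverse>"
    unfolding R R' by auto
  have "(3, perm123, R) \<sim>\<^sub>j\<^sub>d (3, perm132, R)"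
    unfolding R by (rule jointly_equidistributed_shading)
  then show ?thesis
    unfolding R'_eq by (blast intro: jointly_equidistributed_converse)
qed

end
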